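(* Let $G$ be a group which admits a limiting sequence pair. Then $G$ is n-slender, cm-slender and lcH-slender.
   Context: Throughout, $\mathbb{N}=\{1,2,3,\dots\}$. For a subset $S$ of a group $G$ and $j\in\mathbb{N}$, the $j$-th radical of $S$ is $\sqrt[j]{S}=\{g\in G\mid g^j\in S\}$. A limiting sequence pair for $G$ is a pair consisting of a sequence of subsets $F_1\subseteq F_2\subseteq\cdots$ of $G$ and a sequence $k_1,k_2,\dots$ of natural numbers such that for every $n\in\mathbb{N}$: (1) for every $g\in G$ there is $m\in\mathbb{N}$ with $gF_n\subseteq F_m$; (2) $\sqrt[k_n]{F_n}=\{1_G\}$; (3) $\sqrt[k_m]{F_n}\subseteq F_n$ for all $m\le n$. Let $E=\bigcup_{n\in\mathbb{N}}C((0,\tfrac1n),\tfrac1n)\subseteq\mathbb{R}^2$ be the Hawaiian earring ($C(q,r)$ the circle of center $q$, radius $r$), and $\mathbb{H}=\pi_1(E,(0,0))$. For $N\in\mathbb{N}$ let $p_N:\mathbb{H}\to\mathbb{H}$ be the homomorphism induced by the retraction of $E$ onto the union of the first $N$ circles which collapses all other circles to the base point (so $p_N$ is a retraction onto a free subgroup of rank $N$). A group $G$ is n-slender if for every homomorphism $\phi:\mathbb{H}\to G$ there is $N\in\mathbb{N}$ with $\phi=\phi\circ p_N$. A group $G$ is cm-slender if every homomorphism from a completely metrizable topological group to $G$ has open kernel. A group $G$ is lcH-slender if every homomorphism from a locally compact Hausdorff topological group to $G$ has open kernel. *)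

theory Defs
  imports "HOL-Analysis.Analysis" "HOL-Algebra.Algebra"
begin

definition radical :: "('a, 'c) monoid_scheme \<Rightarrow> nat \<Rightarrow> 'a set \<Rightarrow> 'a set" where
  "radical G j S = {g \<in> carrier G. g [^]\<^bsub>G\<^esub> j \<in> S}"

text \<open>Sequences are indexed by natural numbers starting at 1; values at index 0 are irrelevant.\<close>
definition limiting_sequence_pair ::
  "('a, 'c) monoid_scheme \<Rightarrow> (nat \<Rightarrow> 'a set) \<Rightarrow> (nat \<Rightarrow> nat) \<Rightarrow> bool" where
  "limiting_sequence_pair G F k \<longleftrightarrow>
     (\<forall>n\<ge>1. F n \<subseteq> carrier G) \<and>
     (\<forall>n\<ge>1. F n \<subseteq> F (Suc n)) \<and>
     (\<forall>n\<ge>1. k n \<ge> 1) \<and>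
     (\<forall>n\<ge>1. \<forall>g\<in>carrier G. \<exists>m\<ge>1. g <#\<^bsub>G\<^esub> F n \<subseteq> F m) \<and>
     (\<forall>n\<ge>1. radical G (k n) (F n) = {\<one>\<^bsub>G\<^esub>}) \<and>
     (\<forall>n\<ge>1. \<forall>m. 1 \<le> m \<and> m \<le> n \<longrightarrow> radical G (k m) (F n) \<subseteq> F n)"

definition hawaiian_earring :: "(real \<times> real) set" where
  "hawaiian_earring = (\<Union>n\<in>{1::nat..}. sphere (0, 1 / real n) (1 / real n))"

definition he_loops :: "(real \<Rightarrow> real \<times> real) set" where
  "he_loops = {p. path p \<and> path_image p \<subseteq> hawaiian_earring \<and>
                  pathstart p = (0,0) \<and> pathfinish p = (0,0)}"

definition he_class :: "(real \<Rightarrow> real \<times> real) \<Rightarrow> (real \<Rightarrow> real \<times> real) set" where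
  "he_class p = {q. homotopic_paths hawaiian_earring p q}"

definition HE_group :: "(real \<Rightarrow> real \<times> real) set monoid" where
  "HE_group = \<lparr> carrier = he_class ` he_loops,
                mult = (\<lambda>A B. he_class ((SOME p. p \<in> A) +++ (SOME q. q \<in> B))),
                one = he_class (linepath (0,0) (0,0)) \<rparr>"

definition he_retraction :: "nat \<Rightarrow> real \<times> real \<Rightarrow> real \<times> real" where
  "he_retraction N x =
     (if x \<in> (\<Union>n\<in>{1..N}. sphere (0, 1 / real n) (1 / real n)) then x else (0,0))"

definition he_proj :: "nat \<Rightarrow> (real \<Rightarrow> real \<times> real) set \<Rightarrow> (real \<Rightarrow> real \<times> real) set" where
  "he_proj N A = he_class (he_retraction N \<circ> (SOME p. p \<in> A))"

definition n_slender :: "('a, 'c) monoid_scheme \<Rightarrow> bool" where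
  "n_slender G \<longleftrightarrow>
     (\<forall>\<phi> \<in> hom HE_group G. \<exists>N\<ge>1. \<forall>x\<in>carrier HE_group. \<phi> x = \<phi> (he_proj N x))"

definition topological_group :: "('b, 'd) monoid_scheme \<Rightarrow> 'b topology \<Rightarrow> bool" where
  "topological_group K T \<longleftrightarrow> group K \<and> topspace T = carrier K \<and>
     continuous_map (prod_topology T T) T (\<lambda>(x, y). x \<otimes>\<^bsub>K\<^esub> y) \<and>
     continuous_map T T (\<lambda>x. inv\<^bsub>K\<^esub> x)"

text \<open>The type argument fixes the (arbitrary) carrier type of the source topological groups;
  since the theorem's type variables are universally quantified, this ranges over all groups.\<close>
definition cm_slender :: "'b itself \<Rightarrow> ('a, 'c) monoid_scheme \<Rightarrow> bool" where
  "cm_slender (_::'b itself) G \<longleftrightarrow>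
     (\<forall>(K::'b monoid) T h. topological_group K T \<and> completely_metrizable_space T \<and>
        h \<in> hom K G \<longrightarrow> openin T (kernel K G h))"

definition lcH_slender :: "'b itself \<Rightarrow> ('a, 'c) monoid_scheme \<Rightarrow> bool" where
  "lcH_slender (_::'b itself) G \<longleftrightarrow>
     (\<forall>(K::'b monoid) T h. topological_group K T \<and> locally_compact_space T \<and>
        Hausdorff_space T \<and> h \<in> hom K G \<longrightarrow> openin T (kernel K G h))"

end

theory Submission
  imports Defs
begin

text \<open>Suppose that a homomorphism \<open>\<phi>\<close> into \<open>G\<close> is nontrivial on elements \<open>h\<^sub>n\<close> arbitrarily close to the
  identity. One solves the equations \<open>y\<^sub>n = h\<^sub>n \<cdot> y\<^sub>n\<^sub>+\<^sub>1 ^ e\<^sub>n\<close> in the source, by completeness, by compactness,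
  or by an infinite concatenation of loops. Their images satisfy \<open>z\<^sub>n = g\<^sub>n \<cdot> z\<^sub>n\<^sub>+\<^sub>1 ^ e\<^sub>n\<close> with
  \<open>g\<^sub>n = \<phi> h\<^sub>n \<noteq> 1\<close>. The exponents \<open>e\<^sub>n\<close> are terms of the sequence \<open>k\<close>, chosen from \<open>g\<^sub>0, \<dots>, g\<^sub>n\<close> alone: if
  \<open>z\<^sub>0 \<in> F\<^sub>j\<close>, then conditions (1) and (3) confine \<open>z\<^sub>1, \<dots>, z\<^sub>j\<close> to sets \<open>F\<^sub>m\<close> with \<open>m\<close> controlled, and a diagonal
  choice of the exponents makes (2) force \<open>z\<^sub>j\<^sub>+\<^sub>1 = 1\<close>. As \<open>z\<^sub>0 \<in> F\<^sub>j\<^sub>+\<^sub>1\<close> too, also \<open>z\<^sub>j\<^sub>+\<^sub>2 = 1\<close>, hence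
  \<open>g\<^sub>j\<^sub>+\<^sub>1 = 1\<close>, a contradiction.\<close>

section \<open>Annihilating exponents\<close>

text \<open>With \<open>f i x = u i * x ^ e i\<close> this is the infinite word solving
  \<open>y n = u n * y (Suc n) ^ e n\<close>, cut off after \<open>d\<close> letters with remainder
  \<open>x\<close>. The recursion adds the innermost map, because passing to the next approximation
  only changes the remainder; \<open>nested_Suc_left\<close> peels off the outermost letter
  instead.\<close>

primrec nested :: "(nat \<Rightarrow> 'a \<Rightarrow> 'a) \<Rightarrow> nat \<Rightarrow> nat \<Rightarrow> 'a \<Rightarrow> 'a" where
  "nested f n 0 x = x"
| "nested f n (Suc d) x = nested f n d (f (n + d) x)"

lemma nested_Suc_left: "nested f n (Suc d) x = f n (nested f (Suc n) d x)"
  by (induction d arbitrary: x) auto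

lemma nested_add: "nested f n (d + d') x = nested f n d (nested f (n + d) d' x)"
  by (induction d' arbitrary: x) (auto simp: add.assoc)

lemma nested_cong:
  assumes "\<And>i x. n \<le> i \<Longrightarrow> i < n + d \<Longrightarrow> f i x = g i x"
  shows "nested f n d x = nested g n d x"
  using assms by (induction d arbitrary: x) auto

lemma nested_invariant:
  assumes "\<And>i x. n \<le> i \<Longrightarrow> i < n + d \<Longrightarrow> P x \<Longrightarrow> P (f i x)" and "P x"
  shows "P (nested f n d x)"
  using assms by (induction d arbitrary: x) auto

text \<open>If left translation by the inverse of \<open>g i\<close> takes the \<open>a\<close>-th
  set into the one with index \<open>\<mu> (g i) a\<close>, this tracks the index of a set
  containing \<open>z n\<close>, given that \<open>z 0\<close> lies in \<open>F (Suc j)\<close>. The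
  start is \<open>Suc j\<close> because the sets are indexed from 1.\<close>

primrec iterated_bound :: "('a \<Rightarrow> nat \<Rightarrow> nat) \<Rightarrow> (nat \<Rightarrow> 'a) \<Rightarrow> nat \<Rightarrow> nat \<Rightarrow> nat" where
  "iterated_bound \<mu> g 0 j = Suc j"
| "iterated_bound \<mu> g (Suc n) j = \<mu> (g n) (iterated_bound \<mu> g n j)"

lemma iterated_bound_cong:
  assumes "\<And>i. i < n \<Longrightarrow> g i = g' i"
  shows "iterated_bound \<mu> g n j = iterated_bound \<mu> g' n j"
  using assms by (induction n) auto

lemma mono_iterated_bound:
  assumes "\<And>x. mono (\<mu> x)"
  shows "mono (iterated_bound \<mu> g n)"
  using assms by (induction n) (auto simp: mono_def)

lemma limiting_sequence_pair_mono:
  assumes "limiting_sequence_pair G F k" "1 \<le> m" "m \<le> n"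
  shows "F m \<subseteq> F n"
  using assms(3)
proof (induction rule: dec_induct)
  case (step i)
  then have "F i \<subseteq> F (Suc i)"
    using assms(1,2) unfolding limiting_sequence_pair_def by (meson order_trans)
  with step show ?case by blast
qed simp

text \<open>\<open>e g n\<close> depends on \<open>g 0, \<dots>, g n\<close> only, so that \<open>g (n + 1)\<close> may be chosen after it.\<close>
definition annihilating_exponents ::
  "('a, 'c) monoid_scheme \<Rightarrow> ((nat \<Rightarrow> 'a) \<Rightarrow> nat \<Rightarrow> nat) \<Rightarrow> bool" where
  "annihilating_exponents G e \<longleftrightarrow>
     (\<forall>g g' n. (\<forall>i\<le>n. g i = g' i) \<longrightarrow> e g n = e g' n) \<and>
     (\<forall>g a. range g \<subseteq> carrier G \<and> a \<in> carrier G \<longrightarrow>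
        (\<exists>N. \<forall>z. z 0 = a \<and>
           (\<forall>i\<le>N. z (Suc i) \<in> carrier G \<and> z i = g i \<otimes>\<^bsub>G\<^esub> z (Suc i) [^]\<^bsub>G\<^esub> e g i) \<longrightarrow>
           g N = \<one>\<^bsub>G\<^esub>))"

lemma annihilating_exponents_cong:
  assumes "annihilating_exponents G e" "\<And>i. i \<le> n \<Longrightarrow> g i = g' i"
  shows "e g n = e g' n"
  using assms unfolding annihilating_exponents_def by blast

text \<open>The exponent is the diagonal choice \<open>k (A g (Suc n) n)\<close>. Let
  \<open>z 0\<close> lie in \<open>F (Suc l)\<close>. For \<open>n < l\<close> the index
  \<open>A g (Suc n) n\<close> is at most \<open>A g (Suc n) l\<close>, so condition (3) keeps
  \<open>z (Suc n)\<close> in the set of the latter index. At \<open>n = l\<close> the two indices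
  agree, and condition (2) gives \<open>z (Suc l) = 1\<close>.\<close>

lemma annihilating_exponents_exist:
  fixes G :: "('a, 'c) monoid_scheme" (structure)
  assumes "group G" and F: "limiting_sequence_pair G F k"
  shows "\<exists>e. annihilating_exponents G e"
proof -
  interpret group G by fact
  have translate: "\<exists>m\<ge>1. g <# F n \<subseteq> F m" if "n \<ge> 1" "g \<in> carrier G" for n g
    using F that by (simp add: limiting_sequence_pair_def)
  have radical_one: "radical G (k n) (F n) = {\<one>}" if "n \<ge> 1" for n
    using F that by (simp add: limiting_sequence_pair_def)
  have radical_closed: "radical G (k m) (F n) \<subseteq> F n" if "1 \<le> m" "m \<le> n" for m n
    using F that by (simp add: limiting_sequence_pair_def)
  note Fmono = limiting_sequence_pair_mono[OF F]
  have "\<forall>g a. \<exists>m. g \<in> carrier G \<longrightarrow> a \<ge> 1 \<longrightarrow> m \<ge> 1 \<and> inv g <# F a \<subseteq> F m"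
    using translate inv_closed by meson
  then obtain m where m: "\<And>g a. g \<in> carrier G \<Longrightarrow> a \<ge> 1 \<Longrightarrow> m g a \<ge> 1 \<and> inv g <# F a \<subseteq> F (m g a)"
    by metis
  \<comment> \<open>The chosen \<open>m g\<close> need not be monotone; summing over all smaller
    indices gives a monotone function above it.\<close>
  define \<mu> where "\<mu> = (\<lambda>g a. \<Sum>i\<le>a. m g i)"
  have \<mu>_mono: "mono (\<mu> g)" for g
    unfolding \<mu>_def by (intro monoI sum_mono2) auto
  have m_le: "m g a \<le> \<mu> g a" for g a
    unfolding \<mu>_def by (rule member_le_sum) auto
  have \<mu>_ge: "\<mu> g a \<ge> 1" if "g \<in> carrier G" "a \<ge> 1" for g a
    using m[OF that] m_le[of g a] by linarith
  have \<mu>: "inv g \<otimes> x \<in> F (\<mu> g a)" if "g \<in> carrier G" "a \<ge> 1" "x \<in> F a" for g a x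
  proof -
    have "inv g \<otimes> x \<in> inv g <# F a"
      using that(3) by (auto simp: l_coset_def)
    then show ?thesis
      using m[OF that(1,2)] Fmono[OF _ m_le[of g a]] by blast
  qed
  define A where "A = iterated_bound \<mu>"
  define e where "e = (\<lambda>g n. k (A g (Suc n) n))"
  have A_mono: "mono (A g n)" for g n
    unfolding A_def by (rule mono_iterated_bound) (rule \<mu>_mono)
  have "\<exists>N. \<forall>z. z 0 = a \<and>
           (\<forall>i\<le>N. z (Suc i) \<in> carrier G \<and> z i = g i \<otimes> z (Suc i) [^] e g i) \<longrightarrow> g N = \<one>"
    if g: "range g \<subseteq> carrier G" and a: "a \<in> carrier G" for g a
  proof -
    have gc: "g i \<in> carrier G" for i using g by auto
    have A_ge: "A g n j \<ge> 1" for n j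
    proof (induction n)
      case (Suc n)
      then show ?case
        using \<mu>_ge[OF gc] by (simp add: A_def)
    qed (simp add: A_def)
    \<comment> \<open>Since 1 is a root of some element of \<open>F 1\<close>, it lies in
      \<open>F 1\<close>. A set containing \<open>a <# F 1\<close> therefore contains
      \<open>a\<close>, so the sets \<open>F n\<close> exhaust the group.\<close>
    have "\<one> \<in> radical G (k 1) (F 1)"
      using radical_one by simp
    then have one_F: "\<one> \<in> F 1"
      by (simp add: radical_def)
    obtain M where "M \<ge> 1" "a <# F 1 \<subseteq> F M"
      using translate[of 1 a] a by auto
    then have "a \<in> F M"
      using one_F a by (force simp: l_coset_def)
    then obtain j where j: "a \<in> F (Suc j)"
      using \<open>M \<ge> 1\<close> by (metis One_nat_def Suc_le_D)
    show ?thesis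
    proof (intro exI[of _ "Suc j"] allI impI)
      fix z
      assume z: "z 0 = a \<and>
           (\<forall>i\<le>Suc j. z (Suc i) \<in> carrier G \<and> z i = g i \<otimes> z (Suc i) [^] e g i)"
      have root: "z (Suc n) \<in> radical G (e g n) (F (A g (Suc n) l))"
        if "z n \<in> F (A g n l)" "n \<le> Suc j" for n l
      proof -
        have "z (Suc n) \<in> carrier G" "z n = g n \<otimes> z (Suc n) [^] e g n"
          using z that(2) by blast+
        moreover from this have "inv (g n) \<otimes> z n = z (Suc n) [^] e g n"
          using gc by (metis inv_solve_left' nat_pow_closed m_closed)
        ultimately show ?thesis
          using \<mu>[OF gc[of n] A_ge that(1)] by (simp add: A_def radical_def)
      qed
      have member: "z n \<in> F (A g n l)" if "z 0 \<in> F (Suc l)" "n \<le> l" "l \<le> Suc j" for n l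
        using that(2)
      proof (induction n)
        case 0
        then show ?case using that by (simp add: A_def)
      next
        case (Suc n)
        then have "A g (Suc n) n \<le> A g (Suc n) l"
          using A_mono[of g "Suc n"] by (simp add: mono_def)
        moreover have "z (Suc n) \<in> radical G (e g n) (F (A g (Suc n) l))"
          using Suc that(3) by (intro root) auto
        ultimately show ?case
          using radical_closed[OF A_ge] unfolding e_def by blast
      qed
      have trivial: "z (Suc l) = \<one>" if "z 0 \<in> F (Suc l)" "l \<le> Suc j" for l
        using root[OF member[OF that(1) order_refl that(2)] that(2)] radical_one[OF A_ge]
        unfolding e_def by blast
      have "z 0 \<in> F (Suc j)" "z 0 \<in> F (Suc (Suc j))"
        using z j Fmono[of "Suc j" "Suc (Suc j)"] by auto
      then have "z (Suc j) = \<one>" "z (Suc (Suc j)) = \<one>"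
        using trivial by auto
      then show "g (Suc j) = \<one>"
        using z gc by (metis order_refl nat_pow_one r_one)
    qed
  qed
  moreover have "e g n = e g' n" if "\<forall>i\<le>n. g i = g' i" for g g' n
    using iterated_bound_cong[of "Suc n" g g' \<mu> n] that by (simp add: e_def A_def)
  ultimately show ?thesis
    unfolding annihilating_exponents_def by blast
qed

section \<open>Topological groups\<close>

lemma continuous_map_group_mult:
  assumes "topological_group K T" "continuous_map W T f" "continuous_map W T g"
  shows "continuous_map W T (\<lambda>x. f x \<otimes>\<^bsub>K\<^esub> g x)"
proof -
  have "continuous_map W T ((\<lambda>(x, y). x \<otimes>\<^bsub>K\<^esub> y) \<circ> (\<lambda>x. (f x, g x)))"
    using assms by (intro continuous_map_compose[OF continuous_map_pairedI])
      (auto simp: topological_group_def)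
  then show ?thesis by (simp add: o_def)
qed

lemma continuous_map_group_const:
  assumes "topological_group K T" "a \<in> carrier K"
  shows "continuous_map W T (\<lambda>x. a)"
  using assms by (auto simp add: topological_group_def)

lemma continuous_map_group_pow:
  assumes "topological_group K T" "continuous_map W T f"
  shows "continuous_map W T (\<lambda>x. f x [^]\<^bsub>K\<^esub> (n::nat))"
proof -
  interpret group K using assms by (simp add: topological_group_def)
  show ?thesis
  proof (induction n)
    case 0
    show ?case
      using continuous_map_group_const[OF assms(1) one_closed] by simp
  next
    case (Suc n)
    then show ?case
      using continuous_map_group_mult[OF assms(1) _ assms(2)] by simp
  qed
qed

lemma continuous_map_nested:
  assumes "topological_group K T" "\<And>i. i < n + d \<Longrightarrow> u i \<in> carrier K"
  shows "continuous_map T T (nested (\<lambda>i x. u i \<otimes>\<^bsub>K\<^esub> x [^]\<^bsub>K\<^esub> (q i :: nat)) n d)"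
  using assms(2)
proof (induction d)
  case 0
  then show ?case by (simp add: nested.simps(1)[abs_def])
next
  case (Suc d)
  have "continuous_map T T (\<lambda>x. u (n + d) \<otimes>\<^bsub>K\<^esub> x [^]\<^bsub>K\<^esub> q (n + d))"
    using Suc.prems assms(1)
    by (intro continuous_map_group_mult continuous_map_group_const continuous_map_group_pow) auto
  moreover have "continuous_map T T (nested (\<lambda>i x. u i \<otimes>\<^bsub>K\<^esub> x [^]\<^bsub>K\<^esub> q i) n d)"
    using Suc by auto
  ultimately show ?case
    by (drule_tac continuous_map_compose) (auto simp: o_def)
qed

text \<open>Translating \<open>U\<close> by a kernel element \<open>a\<close> gives a neighbourhood
  of \<open>a\<close> inside the kernel. Used in the contrapositive: if the kernel is not open,
  every neighbourhood of 1 contains an element with nontrivial image.\<close>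

lemma open_kernel_if_trivial_near_one:
  assumes "topological_group K T" "group G" "\<phi> \<in> hom K G"
    and U: "openin T U" "\<one>\<^bsub>K\<^esub> \<in> U" "\<And>x. x \<in> U \<Longrightarrow> \<phi> x = \<one>\<^bsub>G\<^esub>"
  shows "openin T (kernel K G \<phi>)"
proof -
  interpret group_hom K G \<phi>
    using assms by (simp add: group_hom_def group_hom_axioms_def topological_group_def)
  have top: "topspace T = carrier K"
    using assms by (simp add: topological_group_def)
  show ?thesis
  proof (subst openin_subopen, intro ballI)
    fix a assume "a \<in> kernel K G \<phi>"
    then have a: "a \<in> carrier K" "\<phi> a = \<one>\<^bsub>G\<^esub>"
      by (auto simp: kernel_def)
    let ?V = "{x \<in> topspace T. inv\<^bsub>K\<^esub> a \<otimes>\<^bsub>K\<^esub> x \<in> U}"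
    have "openin T ?V"
      using a assms(1) U(1)
      by (intro openin_continuous_map_preimage[of T T] continuous_map_group_mult
            continuous_map_group_const) auto
    moreover have "a \<in> ?V"
      using a U top by auto
    moreover have "?V \<subseteq> kernel K G \<phi>"
    proof
      fix x assume x: "x \<in> ?V"
      then have "\<phi> (inv\<^bsub>K\<^esub> a \<otimes>\<^bsub>K\<^esub> x) = \<one>\<^bsub>G\<^esub>" "x \<in> carrier K"
        using U(3) top by auto
      then show "x \<in> kernel K G \<phi>"
        using a by (simp add: kernel_def)
    qed
    ultimately show "\<exists>V. openin T V \<and> a \<in> V \<and> V \<subseteq> kernel K G \<phi>"
      by blast
  qed
qed

text \<open>The exponent at \<open>i\<close> reads only the letters up to \<open>i\<close>, so a
  finite word ignores all later letters. This makes the recursive choice of letters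
  legitimate.\<close>

lemma nested_words_cong:
  assumes e: "annihilating_exponents G e" and u: "\<And>i. i < n + d \<Longrightarrow> u i = u' i"
  shows "nested (\<lambda>i x. u i \<otimes>\<^bsub>K\<^esub> x [^]\<^bsub>K\<^esub> e (\<phi> \<circ> u) i) n d x =
    nested (\<lambda>i x. u' i \<otimes>\<^bsub>K\<^esub> x [^]\<^bsub>K\<^esub> e (\<phi> \<circ> u') i) n d x"
proof (rule nested_cong)
  fix i x
  assume "i < n + d"
  then have "e (\<phi> \<circ> u) i = e (\<phi> \<circ> u') i"
    using u by (intro annihilating_exponents_cong[OF e]) simp
  then show "u i \<otimes>\<^bsub>K\<^esub> x [^]\<^bsub>K\<^esub> e (\<phi> \<circ> u) i = u' i \<otimes>\<^bsub>K\<^esub> x [^]\<^bsub>K\<^esub> e (\<phi> \<circ> u') i"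
    using u \<open>i < n + d\<close> by simp
qed

text \<open>The common frame of both topological cases. \<open>U u n\<close> is the neighbourhood of
  1 from which letter \<open>n\<close> is drawn once the earlier letters are known. The remainders
  of \<open>x\<close> for different \<open>d\<close> need not be compatible: the bound
  \<open>N\<close> depends only on the letters and on \<open>\<phi> x\<close>, and then one
  remainder after \<open>Suc N\<close> letters yields all the equations required.\<close>

lemma open_kernel_if_nested_words_converge:
  fixes K :: "'b monoid"
  assumes tg: "topological_group K T" and G: "group G" and hom: "\<phi> \<in> hom K G"
    and e: "annihilating_exponents G e"
    and cong: "\<And>u u' n. (\<And>i. i < n \<Longrightarrow> u i = u' i) \<Longrightarrow> U u n = U u' n"
    and nbhd: "\<And>u n. (\<And>i. i < n \<Longrightarrow> u i \<in> U u i) \<Longrightarrow> openin T (U u n) \<and> \<one>\<^bsub>K\<^esub> \<in> U u n"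
    and limit: "\<And>u. (\<And>i. u i \<in> U u i) \<Longrightarrow>
      \<exists>x. \<forall>d. x \<in> nested (\<lambda>i x. u i \<otimes>\<^bsub>K\<^esub> x [^]\<^bsub>K\<^esub> e (\<phi> \<circ> u) i) 0 d ` carrier K"
  shows "openin T (kernel K G \<phi>)"
proof (rule ccontr)
  assume not_open: "\<not> openin T (kernel K G \<phi>)"
  interpret group_hom K G \<phi>
    using tg G hom by (simp add: group_hom_def group_hom_axioms_def topological_group_def)
  have top: "topspace T = carrier K"
    using tg by (simp add: topological_group_def)
  have "\<exists>u. \<forall>n. u n \<in> U u n \<and> \<phi> (u n) \<noteq> \<one>\<^bsub>G\<^esub>"
  proof (rule dependent_wellorder_choice)
    fix r :: 'b and u u' :: "nat \<Rightarrow> 'b" and n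
    assume "\<And>i. i < n \<Longrightarrow> u i = u' i"
    then have "U u n = U u' n"
      by (rule cong)
    then show "(r \<in> U u n \<and> \<phi> r \<noteq> \<one>\<^bsub>G\<^esub>) = (r \<in> U u' n \<and> \<phi> r \<noteq> \<one>\<^bsub>G\<^esub>)"
      by simp
  next
    fix n and u :: "nat \<Rightarrow> 'b"
    assume "\<And>i. i < n \<Longrightarrow> u i \<in> U u i \<and> \<phi> (u i) \<noteq> \<one>\<^bsub>G\<^esub>"
    then have "openin T (U u n)" "\<one>\<^bsub>K\<^esub> \<in> U u n"
      using nbhd[of n u] by auto
    then show "\<exists>r. r \<in> U u n \<and> \<phi> r \<noteq> \<one>\<^bsub>G\<^esub>"
      using open_kernel_if_trivial_near_one[OF tg G hom] not_open by blast
  qed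
  then obtain u where u: "\<And>n. u n \<in> U u n" and nontrivial: "\<And>n. \<phi> (u n) \<noteq> \<one>\<^bsub>G\<^esub>"
    by blast
  have uc: "u n \<in> carrier K" for n
    using u nbhd[of n u] openin_subset top by blast
  let ?f = "\<lambda>i x. u i \<otimes>\<^bsub>K\<^esub> x [^]\<^bsub>K\<^esub> e (\<phi> \<circ> u) i"
  have closed: "nested ?f n d x \<in> carrier K" if "x \<in> carrier K" for n d x
    using that uc by (intro nested_invariant[of _ _ "\<lambda>x. x \<in> carrier K"]) auto
  obtain x where x: "\<And>d. x \<in> nested ?f 0 d ` carrier K"
    using limit u by blast
  have "x \<in> carrier K"
    using x[of 0] by auto
  moreover have "range (\<phi> \<circ> u) \<subseteq> carrier G"
    using uc by auto
  ultimately have "\<exists>N. \<forall>z. z 0 = \<phi> x \<and>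
      (\<forall>i\<le>N. z (Suc i) \<in> carrier G \<and>
        z i = (\<phi> \<circ> u) i \<otimes>\<^bsub>G\<^esub> z (Suc i) [^]\<^bsub>G\<^esub> e (\<phi> \<circ> u) i) \<longrightarrow> (\<phi> \<circ> u) N = \<one>\<^bsub>G\<^esub>"
    using e hom_closed unfolding annihilating_exponents_def by blast
  then obtain N where N: "\<And>z. z 0 = \<phi> x \<and>
      (\<forall>i\<le>N. z (Suc i) \<in> carrier G \<and>
        z i = (\<phi> \<circ> u) i \<otimes>\<^bsub>G\<^esub> z (Suc i) [^]\<^bsub>G\<^esub> e (\<phi> \<circ> u) i) \<Longrightarrow> (\<phi> \<circ> u) N = \<one>\<^bsub>G\<^esub>"
    by blast
  obtain y where y: "y \<in> carrier K" "x = nested ?f 0 (Suc N) y"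
    using x by blast
  \<comment> \<open>The image of the part of the word from letter \<open>i\<close> on. At
    \<open>i = 0\<close> it is \<open>\<phi> x\<close>; for \<open>i > N\<close> the truncated
    subtraction turns it into \<open>\<phi> y\<close>.\<close>
  let ?z = "\<lambda>i. \<phi> (nested ?f i (Suc N - i) y)"
  have "?z (Suc i) \<in> carrier G \<and>
      ?z i = (\<phi> \<circ> u) i \<otimes>\<^bsub>G\<^esub> ?z (Suc i) [^]\<^bsub>G\<^esub> e (\<phi> \<circ> u) i" if "i \<le> N" for i
  proof -
    define v where "v = nested ?f (Suc i) (Suc N - Suc i) y"
    have v: "v \<in> carrier K"
      unfolding v_def by (rule closed) fact
    have "nested ?f i (Suc N - i) y = u i \<otimes>\<^bsub>K\<^esub> v [^]\<^bsub>K\<^esub> e (\<phi> \<circ> u) i"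
      unfolding v_def using that nested_Suc_left[of ?f i "N - i" y]
      by (simp only: Suc_diff_le diff_Suc_Suc)
    moreover have "\<phi> (u i \<otimes>\<^bsub>K\<^esub> v [^]\<^bsub>K\<^esub> m) = \<phi> (u i) \<otimes>\<^bsub>G\<^esub> \<phi> v [^]\<^bsub>G\<^esub> m" for m :: nat
      using v uc by (simp add: hom_nat_pow)
    ultimately show ?thesis
      using hom_closed[OF v] by (simp only: v_def comp_apply simp_thms)
  qed
  then have "(\<phi> \<circ> u) N = \<one>\<^bsub>G\<^esub>"
    using y(2) by (intro N[of ?z]) auto
  then show False
    using nontrivial by simp
qed

section \<open>Completely metrizable source groups\<close>

lemma completely_metrizable_open_kernel:
  fixes K :: "'b monoid"
  assumes tg: "topological_group K T" and G: "group G" and hom: "\<phi> \<in> hom K G"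
    and e: "annihilating_exponents G e"
    and cm: "completely_metrizable_space T"
  shows "openin T (kernel K G \<phi>)"
proof -
  obtain M dm where M: "Metric_space M dm" "Metric_space.mcomplete M dm"
    and T: "T = Metric_space.mtopology M dm"
    using cm unfolding completely_metrizable_space_def by blast
  interpret Metric_space M dm by (fact M(1))
  have top: "topspace T = carrier K"
    using tg by (simp add: topological_group_def)
  then have MK: "M = carrier K"
    by (simp add: T)
  interpret group K
    using tg by (simp add: topological_group_def)
  define f where "f = (\<lambda>u i x. u i \<otimes>\<^bsub>K\<^esub> x [^]\<^bsub>K\<^esub> e (\<phi> \<circ> u) i)"
  \<comment> \<open>Letter \<open>n\<close> is so close to 1 that inserting it as the innermost
    letter moves the word by less than \<open>(1/2) ^ n\<close>. This is demanded for the words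
    starting at every \<open>i \<le> n\<close>, so that all remainders converge and not only the
    whole word; these are finitely many open conditions.\<close>
  define U where "U = (\<lambda>u n. {x \<in> carrier K. \<forall>i\<le>n.
    dm (nested (f u) i (n - i) \<one>\<^bsub>K\<^esub>) (nested (f u) i (n - i) x) < (1/2) ^ n})"
  have f_one: "f u i \<one>\<^bsub>K\<^esub> = u i" if "u i \<in> carrier K" for u i
    using that by (simp add: f_def)
  have cont: "continuous_map T T (nested (f u) n d)" if "\<And>i. i < n + d \<Longrightarrow> u i \<in> carrier K" for u n d
    unfolding f_def using continuous_map_nested[OF tg that] .
  have closed: "nested (f u) n d x \<in> M"
    if "\<And>i. i < n + d \<Longrightarrow> u i \<in> carrier K" "x \<in> M" for u n d x
    using continuous_map_image_subset_topspace[OF cont[of n d u]] that unfolding top MK by blast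
  show ?thesis
  proof (rule open_kernel_if_nested_words_converge[OF tg G hom e, where U = U])
    fix u u' :: "nat \<Rightarrow> 'b" and n
    assume "\<And>i. i < n \<Longrightarrow> u i = u' i"
    then have "nested (f u) i (n - i) x = nested (f u') i (n - i) x" if "i \<le> n" for i x
      unfolding f_def using that by (intro nested_words_cong[OF e]) simp
    then show "U u n = U u' n"
      by (simp add: U_def)
  next
    fix u n
    assume u: "\<And>i. i < n \<Longrightarrow> u i \<in> U u i"
    then have uc: "u i \<in> carrier K" if "i < n" for i
      using that by (auto simp: U_def)
    have cl: "nested (f u) i (n - i) x \<in> M" if "i \<le> n" "x \<in> M" for i x
      using that uc by (intro closed) auto
    have "U u n = (\<Inter>i\<le>n. {x \<in> topspace T.
        nested (f u) i (n - i) x \<in> mball (nested (f u) i (n - i) \<one>\<^bsub>K\<^esub>) ((1/2) ^ n)})"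
      using cl one_closed by (auto simp: U_def top simp flip: MK)
    moreover have "openin T \<dots>"
      using uc by (intro openin_INT2 openin_continuous_map_preimage[OF cont]) (auto simp: T)
    moreover have "\<one>\<^bsub>K\<^esub> \<in> U u n"
      using cl one_closed by (simp add: U_def flip: MK)
    ultimately show "openin T (U u n) \<and> \<one>\<^bsub>K\<^esub> \<in> U u n"
      by simp
  next
    fix u
    assume u: "\<And>i. u i \<in> U u i"
    then have uc: "u i \<in> carrier K" for i
      by (auto simp: U_def)
    define \<sigma> where "\<sigma> = (\<lambda>n d. nested (f u) n d \<one>\<^bsub>K\<^esub>)"
    have \<sigma>_M: "\<sigma> n d \<in> M" for n d
      unfolding \<sigma>_def using uc one_closed by (intro closed) (simp_all add: MK)
    have step: "dm (\<sigma> n d) (\<sigma> n (Suc d)) \<le> (1/2) ^ d" for n d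
    proof -
      have "dm (\<sigma> n d) (\<sigma> n (Suc d)) < (1/2) ^ (n + d)"
      proof -
        have "dm (nested (f u) n (n + d - n) \<one>\<^bsub>K\<^esub>) (nested (f u) n (n + d - n) (u (n + d))) < (1/2) ^ (n + d)"
          using u[of "n + d"] le_add1[of n d] unfolding U_def by blast
        then show ?thesis
          by (simp add: \<sigma>_def f_one[OF uc])
      qed
      also have "\<dots> \<le> (1/2) ^ d"
        by (intro power_decreasing) auto
      finally show ?thesis by simp
    qed
    \<comment> \<open>The right-hand side is the exact geometric sum of the step bounds, which lets
      the induction close.\<close>
    have tail: "dm (\<sigma> n d) (\<sigma> n (d + p)) \<le> 2 * (1/2) ^ d - 2 * (1/2) ^ (d + p)" for n d p
    proof (induction p)
      case (Suc p)
      have "dm (\<sigma> n d) (\<sigma> n (d + Suc p)) \<le> dm (\<sigma> n d) (\<sigma> n (d + p)) + dm (\<sigma> n (d + p)) (\<sigma> n (Suc (d + p)))"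
        using triangle \<sigma>_M by simp
      then show ?case
        using Suc step[of n "d + p"] by simp
    qed (simp add: \<sigma>_M)
    have "MCauchy (\<sigma> n)" for n
      unfolding MCauchy_def
    proof (intro conjI allI impI)
      show "range (\<sigma> n) \<subseteq> M"
        using \<sigma>_M by auto
      fix \<epsilon> :: real
      assume "\<epsilon> > 0"
      then obtain N where N: "(1/2) ^ N < \<epsilon> / 4"
        using real_arch_pow_inv[of "\<epsilon> / 4" "1/2"] by auto
      have near: "dm (\<sigma> n N) (\<sigma> n i) < \<epsilon> / 2" if "N \<le> i" for i
      proof -
        have "dm (\<sigma> n N) (\<sigma> n i) \<le> 2 * (1/2) ^ N - 2 * (1/2) ^ i"
          using tail[of n N "i - N"] that by simp
        moreover have "(0::real) < (1/2) ^ i"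
          by simp
        ultimately show ?thesis
          using N by linarith
      qed
      have "dm (\<sigma> n i) (\<sigma> n j) < \<epsilon>" if "N \<le> i" "N \<le> j" for i j
      proof -
        have "dm (\<sigma> n i) (\<sigma> n j) \<le> dm (\<sigma> n i) (\<sigma> n N) + dm (\<sigma> n N) (\<sigma> n j)"
          using triangle \<sigma>_M by simp
        then show ?thesis
          using near[OF that(1)] near[OF that(2)] commute[of "\<sigma> n i" "\<sigma> n N"] by linarith
      qed
      then show "\<exists>N. \<forall>i j. N \<le> i \<longrightarrow> N \<le> j \<longrightarrow> dm (\<sigma> n i) (\<sigma> n j) < \<epsilon>"
        by blast
    qed
    then have "\<exists>l. limitin T (\<sigma> n) l sequentially" for n
      using M(2) unfolding mcomplete_def T by blast
    then obtain y where y: "\<And>n. limitin T (\<sigma> n) (y n) sequentially"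
      by metis
    then have yc: "y n \<in> carrier K" for n
      using limitin_topspace[OF y] top by simp
    \<comment> \<open>Both sides are limits of the shifted sequence
      \<open>\<sigma> n (Suc d)\<close>: the left one by the shift, the right one by continuity of
      the outermost map.\<close>
    have y_Suc: "y n = f u n (y (Suc n))" for n
    proof (rule limitin_Hausdorff_unique)
      show "Hausdorff_space T"
        unfolding T by (rule Hausdorff_space_mtopology)
      show "limitin T (\<lambda>d. \<sigma> n (Suc d)) (y n) sequentially"
        using y limitin_sequentially_offset[of T "\<sigma> n" "y n" 1] by simp
      have "continuous_map T T (f u n)"
        using cont[of n 1 u] uc by (simp add: nested.simps[abs_def] comp_def)
      then have "limitin T (f u n \<circ> \<sigma> (Suc n)) (f u n (y (Suc n))) sequentially"
        using y by (rule continuous_map_limit)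
      moreover have "f u n \<circ> \<sigma> (Suc n) = (\<lambda>d. \<sigma> n (Suc d))"
        unfolding \<sigma>_def nested_Suc_left by auto
      ultimately show "limitin T (\<lambda>d. \<sigma> n (Suc d)) (f u n (y (Suc n))) sequentially"
        by simp
    qed simp
    have "y 0 = nested (f u) 0 d (y d)" for d
      by (induction d) (simp_all flip: y_Suc)
    then show "\<exists>x. \<forall>d. x \<in> nested (\<lambda>i x. u i \<otimes>\<^bsub>K\<^esub> x [^]\<^bsub>K\<^esub> e (\<phi> \<circ> u) i) 0 d ` carrier K"
      using yc unfolding f_def by blast
  qed
qed

section \<open>Locally compact Hausdorff source groups\<close>

lemma locally_compact_Hausdorff_open_kernel:
  fixes K :: "'b monoid"
  assumes tg: "topological_group K T" and G: "group G" and hom: "\<phi> \<in> hom K G"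
    and e: "annihilating_exponents G e"
    and lc: "locally_compact_space T" and haus: "Hausdorff_space T"
  shows "openin T (kernel K G \<phi>)"
proof -
  have top: "topspace T = carrier K"
    using tg by (simp add: topological_group_def)
  interpret group K
    using tg by (simp add: topological_group_def)
  obtain W C where W: "openin T W" "compactin T C" "\<one>\<^bsub>K\<^esub> \<in> W" "W \<subseteq> C"
    using lc one_closed unfolding locally_compact_space_def top[symmetric] by metis
  have C: "C \<subseteq> carrier K" "closedin T C"
    using compactin_subset_topspace[OF W(2)] compactin_imp_closedin[OF haus W(2)] top by simp_all
  define f where "f = (\<lambda>u i x. u i \<otimes>\<^bsub>K\<^esub> x [^]\<^bsub>K\<^esub> e (\<phi> \<circ> u) i)"
  \<comment> \<open>Compactness replaces smallness: all finite words ending in letter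
    \<open>n\<close> have to stay in \<open>W\<close>, hence in the compact set
    \<open>C\<close>.\<close>
  define U where "U = (\<lambda>u n. {x \<in> carrier K. \<forall>i\<le>n. nested (f u) i (n - i) x \<in> W})"
  have f_one: "f u i \<one>\<^bsub>K\<^esub> = u i" if "u i \<in> carrier K" for u i
    using that by (simp add: f_def)
  have cont: "continuous_map T T (nested (f u) n d)" if "\<And>i. i < n + d \<Longrightarrow> u i \<in> carrier K" for u n d
    unfolding f_def using continuous_map_nested[OF tg that] .
  show ?thesis
  proof (rule open_kernel_if_nested_words_converge[OF tg G hom e, where U = U])
    fix u u' :: "nat \<Rightarrow> 'b" and n
    assume "\<And>i. i < n \<Longrightarrow> u i = u' i"
    then have "nested (f u) i (n - i) x = nested (f u') i (n - i) x" if "i \<le> n" for i x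
      unfolding f_def using that by (intro nested_words_cong[OF e]) simp
    then show "U u n = U u' n"
      by (simp add: U_def)
  next
    fix u n
    assume u: "\<And>i. i < n \<Longrightarrow> u i \<in> U u i"
    then have uc: "u i \<in> carrier K" if "i < n" for i
      using that by (auto simp: U_def)
    have "U u n = (\<Inter>i\<le>n. {x \<in> topspace T. nested (f u) i (n - i) x \<in> W})"
      by (auto simp: U_def top)
    moreover have "openin T \<dots>"
      using uc by (intro openin_INT2 openin_continuous_map_preimage[OF cont] W) auto
    \<comment> \<open>A word with remainder 1 is the shorter word whose remainder is its last
      letter, and that letter was chosen to keep the word in \<open>W\<close>.\<close>
    moreover have "nested (f u) i (n - i) \<one>\<^bsub>K\<^esub> \<in> W" if "i \<le> n" for i
    proof (cases "i = n")
      case False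
      with that obtain m where m: "n = Suc m" "i \<le> m"
        by (cases n) auto
      then have "nested (f u) i (n - i) \<one>\<^bsub>K\<^esub> = nested (f u) i (m - i) (u m)"
        using f_one uc by (simp add: Suc_diff_le)
      then show ?thesis
        using u[of m] m by (simp add: U_def)
    qed (simp add: W)
    ultimately show "openin T (U u n) \<and> \<one>\<^bsub>K\<^esub> \<in> U u n"
      by (simp add: U_def top)
  next
    fix u
    assume u: "\<And>i. u i \<in> U u i"
    then have uc: "u i \<in> carrier K" for i
      by (auto simp: U_def)
    define V where "V = (\<lambda>n. {x \<in> C. \<forall>i\<le>n. nested (f u) i (n - i) x \<in> C})"
    have V_Suc: "f u n x \<in> V n" if "x \<in> V (Suc n)" for n x
    proof -
      have "nested (f u) i (n - i) (f u n x) \<in> C" if "i \<le> n" for i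
      proof -
        have "nested (f u) i (Suc n - i) x \<in> C"
          using \<open>x \<in> V (Suc n)\<close> that by (simp add: V_def)
        then show ?thesis
          using that by (simp add: Suc_diff_le)
      qed
      from this this[of n] show ?thesis
        by (simp add: V_def)
    qed
    have "\<one>\<^bsub>K\<^esub> \<in> V n" for n
    proof (cases n)
      case (Suc m)
      have "nested (f u) i (Suc m - i) \<one>\<^bsub>K\<^esub> \<in> C" if "i \<le> Suc m" for i
        using that u[of m] W f_one[OF uc] by (cases "i = Suc m") (auto simp: U_def Suc_diff_le)
      then show ?thesis
        using W Suc by (auto simp: V_def)
    qed (use W in \<open>auto simp: V_def\<close>)
    then have nonempty: "nested (f u) 0 n ` V n \<noteq> {}" for n
      by auto
    have "closedin T (V n)" for n
    proof -
      have "V n = C \<inter> (\<Inter>i\<le>n. {x \<in> topspace T. nested (f u) i (n - i) x \<in> C})"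
        using C by (auto simp: V_def top)
      moreover have "closedin T \<dots>"
        using uc C by (intro closedin_Int closedin_INT closedin_continuous_map_preimage[OF cont]) auto
      ultimately show ?thesis by simp
    qed
    then have "compactin T (V n)" for n
      by (rule closed_compactin[OF W(2), rotated]) (auto simp: V_def)
    then have compact: "compactin T (nested (f u) 0 n ` V n)" for n
      using cont uc by (intro image_compactin[of T]) auto
    have "nested (f u) 0 (Suc n) ` V (Suc n) \<subseteq> nested (f u) 0 n ` V n" for n
      using V_Suc by auto
    then have decseq: "decseq (\<lambda>n. nested (f u) 0 n ` V n)"
      by (rule decseq_SucI)
    have "nested (f u) 0 n ` V n \<subseteq> C" for n
      by (auto simp: V_def)
    then have "closedin (subtopology T C) (nested (f u) 0 n ` V n)" for n
      using compactin_imp_closedin[OF haus compact] by (rule closedin_subset_topspace[rotated])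
    moreover have "compact_space (subtopology T C)"
      using W by (simp add: compact_space_subtopology)
    ultimately have "(\<Inter>n. nested (f u) 0 n ` V n) \<noteq> {}"
      using nonempty decseq by (intro compact_space_imp_nest)
    then obtain x where "\<And>n. x \<in> nested (f u) 0 n ` V n"
      by blast
    moreover have "V n \<subseteq> carrier K" for n
      using C by (auto simp: V_def)
    ultimately show "\<exists>x. \<forall>d. x \<in> nested (\<lambda>i x. u i \<otimes>\<^bsub>K\<^esub> x [^]\<^bsub>K\<^esub> e (\<phi> \<circ> u) i) 0 d ` carrier K"
      unfolding f_def by blast
  qed
qed

section \<open>The Hawaiian earring\<close>

definition earring_circle :: "nat \<Rightarrow> (real \<times> real) set" where
  "earring_circle n = sphere (0, 1 / real n) (1 / real n)"

definition earring_head :: "nat \<Rightarrow> (real \<times> real) set" where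
  "earring_head N = (\<Union>n\<in>{1..N}. earring_circle n)"

definition earring_tail :: "nat \<Rightarrow> (real \<times> real) set" where
  "earring_tail N = (\<Union>n\<in>{N..}. earring_circle n)"

lemma hawaiian_earring_eq_tail: "hawaiian_earring = earring_tail 1"
  by (simp add: hawaiian_earring_def earring_tail_def earring_circle_def)

lemma hawaiian_earring_eq_Un: "hawaiian_earring = earring_head N \<union> earring_tail (Suc N)"
proof -
  have "{1..} = {1..N} \<union> {Suc N..}"
    by auto
  then show ?thesis
    unfolding hawaiian_earring_eq_tail earring_tail_def earring_head_def by blast
qed

text \<open>In this form the equation is linear in \<open>n\<close>: away from the origin a point
  determines the number of its circle as \<open>2 * y / (x^2 + y^2)\<close>.\<close>

lemma mem_earring_circle_iff:
  assumes "n \<ge> 1"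
  shows "(x, y) \<in> earring_circle n \<longleftrightarrow> real n * (x\<^sup>2 + y\<^sup>2) = 2 * y"
proof -
  have "(x, y) \<in> earring_circle n \<longleftrightarrow> sqrt (x\<^sup>2 + (1 / real n - y)\<^sup>2) = 1 / real n"
    by (simp add: earring_circle_def dist_Pair_Pair dist_real_def)
  also have "\<dots> \<longleftrightarrow> x\<^sup>2 + (1 / real n - y)\<^sup>2 = (1 / real n)\<^sup>2"
    by (metis abs_of_nonneg of_nat_0_le_iff real_sqrt_abs real_sqrt_eq_iff zero_le_divide_1_iff)
  also have "\<dots> \<longleftrightarrow> x\<^sup>2 + (1 / real n - y)\<^sup>2 - (1 / real n)\<^sup>2 = 0"
    by simp
  also have "x\<^sup>2 + (1 / real n - y)\<^sup>2 - (1 / real n)\<^sup>2 = (real n * (x\<^sup>2 + y\<^sup>2) - 2 * y) / real n"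
    using assms by (simp add: power2_eq_square field_simps)
  also have "\<dots> = 0 \<longleftrightarrow> real n * (x\<^sup>2 + y\<^sup>2) = 2 * y"
    using assms by simp
  finally show ?thesis .
qed

lemma norm_le_earring_circle:
  assumes "p \<in> earring_circle n"
  shows "norm p \<le> 2 / real n"
proof -
  have "norm p \<le> norm (p - (0, 1 / real n)) + norm (0::real, 1 / real n)"
    by (metis diff_add_cancel norm_triangle_ineq)
  also have "\<dots> = 1 / real n + 1 / real n"
    using assms by (simp add: earring_circle_def dist_norm norm_minus_commute norm_Pair)
  finally show ?thesis by simp
qed

lemma zero_in_earring_circle: "n \<ge> 1 \<Longrightarrow> (0, 0) \<in> earring_circle n"
  by (simp add: mem_earring_circle_iff)

lemma zero_in_hawaiian_earring: "(0, 0) \<in> hawaiian_earring"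
  using zero_in_earring_circle[of 1] by (auto simp: hawaiian_earring_eq_tail earring_tail_def)

lemma closed_earring_head: "closed (earring_head N)"
  unfolding earring_head_def earring_circle_def by (intro closed_UN) auto

text \<open>The union is infinite, but the origin belongs to it, and near any other point
  \<open>p\<close> only finitely many circles occur: those with \<open>n \<ge> M\<close> lie in the
  ball of radius \<open>norm p / 2\<close>.\<close>

lemma closed_earring_tail:
  assumes "N \<ge> 1"
  shows "closed (earring_tail N)"
  unfolding closed_def
proof (subst open_subopen, intro ballI)
  fix p assume p: "p \<in> - earring_tail N"
  have "(0, 0) \<in> earring_tail N"
    using zero_in_earring_circle[of N] assms by (auto simp: earring_tail_def)
  then have pos: "norm p > 0"
    using p by (auto simp: zero_prod_def)
  then obtain M where M: "4 / norm p < real M"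
    using reals_Archimedean2 by blast
  have near: "norm q \<le> norm p / 2" if "q \<in> earring_circle n" "n \<ge> M" for q n
  proof -
    have "0 < 4 / norm p" "4 / norm p < real n"
      using pos M that(2) by (simp, meson less_le_trans of_nat_le_iff)
    moreover from this have "0 < real n"
      by linarith
    ultimately have "2 / real n \<le> norm p / 2"
      using pos by (simp add: field_simps)
    then show ?thesis
      using norm_le_earring_circle[OF that(1)] by linarith
  qed
  define S where "S = (\<Union>n\<in>{N..<M}. earring_circle n)"
  have "closed S"
    unfolding S_def earring_circle_def by (intro closed_UN) auto
  moreover have "p \<notin> S"
    using p by (auto simp: S_def earring_tail_def)
  moreover have "- cball 0 (norm p / 2) \<inter> - S \<subseteq> - earring_tail N"
  proof
    fix q assume q: "q \<in> - cball 0 (norm p / 2) \<inter> - S"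
    have "q \<notin> earring_circle n" if "n \<ge> N" for n
      using q near[of q n] that by (cases "n < M") (auto simp: S_def)
    then show "q \<in> - earring_tail N"
      by (auto simp: earring_tail_def)
  qed
  ultimately show "\<exists>T. open T \<and> p \<in> T \<and> T \<subseteq> - earring_tail N"
    using pos by (intro exI[of _ "- cball 0 (norm p / 2) \<inter> - S"]) (auto intro!: open_Int)
qed

lemma closed_hawaiian_earring: "closed hawaiian_earring"
  by (simp add: hawaiian_earring_eq_tail closed_earring_tail)

lemma earring_circle_Int:
  assumes "1 \<le> m" "1 \<le> n" "m \<noteq> n" "p \<in> earring_circle m" "p \<in> earring_circle n"
  shows "p = (0, 0)"
proof -
  obtain x y where p: "p = (x, y)" by fastforce
  have "real m * (x\<^sup>2 + y\<^sup>2) = real n * (x\<^sup>2 + y\<^sup>2)"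
    using assms by (simp add: p mem_earring_circle_iff)
  then have "x\<^sup>2 + y\<^sup>2 = 0"
    using assms(3) by (metis mult_right_cancel of_nat_eq_iff)
  then show ?thesis
    by (simp add: p sum_power2_eq_zero_iff)
qed

lemma earring_head_Int_tail:
  assumes "p \<in> earring_head N" "p \<in> earring_tail (Suc N)"
  shows "p = (0, 0)"
proof -
  obtain m where "1 \<le> m" "m \<le> N" "p \<in> earring_circle m"
    using assms(1) by (auto simp: earring_head_def)
  moreover obtain n where "Suc N \<le> n" "p \<in> earring_circle n"
    using assms(2) by (auto simp: earring_tail_def)
  ultimately show ?thesis
    by (intro earring_circle_Int[of m n]) auto
qed

lemma he_retraction_eq: "he_retraction N p = (if p \<in> earring_head N then p else (0, 0))"
  by (simp add: he_retraction_def earring_head_def earring_circle_def)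

text \<open>Gluing on two closed sets that meet at most in the origin, where both branches
  vanish.\<close>

lemma continuous_on_he_retraction: "continuous_on hawaiian_earring (he_retraction N)"
  unfolding hawaiian_earring_eq_Un[of N]
proof (rule continuous_on_closed_Un)
  have "continuous_on (earring_head N) (\<lambda>p. p)"
    by (rule continuous_on_id)
  then show "continuous_on (earring_head N) (he_retraction N)"
    by (rule continuous_on_eq) (simp add: he_retraction_eq)
  have "continuous_on (earring_tail (Suc N)) (\<lambda>p. (0::real, 0::real))"
    by (rule continuous_on_const)
  then show "continuous_on (earring_tail (Suc N)) (he_retraction N)"
    by (rule continuous_on_eq) (auto simp: he_retraction_eq dest: earring_head_Int_tail)
qed (auto intro: closed_earring_head closed_earring_tail)

lemma he_retraction_in: "p \<in> hawaiian_earring \<Longrightarrow> he_retraction N p \<in> hawaiian_earring"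
  by (simp add: he_retraction_eq zero_in_hawaiian_earring)

lemma norm_he_retraction_le: "norm (he_retraction N p) \<le> norm p"
  by (simp add: he_retraction_eq flip: zero_prod_def)

lemma he_retraction_zero: "he_retraction N (0, 0) = (0, 0)"
  by (simp add: he_retraction_eq)

text \<open>Off the origin the number of the circle is the continuous function \<open>c\<close>. A
  connected set meeting circles on both sides of the cut would attain the value
  \<open>N + 1/2\<close>, but \<open>c\<close> takes only integer values on the earring.\<close>

lemma connected_hawaiian_earring_subset:
  assumes "connected S" "S \<subseteq> hawaiian_earring - {(0, 0)}"
  shows "S \<subseteq> earring_head N \<or> S \<subseteq> earring_tail (Suc N)"
proof (rule ccontr)
  define c where "c = (\<lambda>p :: real \<times> real. 2 * snd p / ((fst p)\<^sup>2 + (snd p)\<^sup>2))"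
  have c: "c p = real n" if "p \<in> earring_circle n" "p \<noteq> (0, 0)" "n \<ge> 1" for p n
  proof -
    obtain x y where p: "p = (x, y)" by fastforce
    have "x\<^sup>2 + y\<^sup>2 \<noteq> 0"
      using that(2) by (simp add: p sum_power2_eq_zero_iff)
    then show ?thesis
      using that by (simp add: c_def p mem_earring_circle_iff field_simps)
  qed
  assume "\<not> ?thesis"
  then obtain p q where pq: "p \<in> S" "p \<notin> earring_tail (Suc N)" "q \<in> S" "q \<notin> earring_head N"
    by blast
  then have "p \<in> earring_head N" "q \<in> earring_tail (Suc N)"
    using assms(2) hawaiian_earring_eq_Un[of N] by blast+
  then obtain m n where mn: "1 \<le> m" "m \<le> N" "p \<in> earring_circle m" "Suc N \<le> n" "q \<in> earring_circle n"
    by (auto simp: earring_head_def earring_tail_def)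
  have "continuous_on S c"
    using assms(2) unfolding c_def
    by (intro continuous_intros) (auto simp: sum_power2_eq_zero_iff prod_eq_iff)
  then have "connected (c ` S)"
    using assms(1) by (rule connected_continuous_image)
  moreover have "c p = real m" "c q = real n"
    using mn pq assms(2) by (auto intro!: c)
  then have "real m \<in> c ` S" "real n \<in> c ` S"
    using pq by (metis imageI)+
  ultimately have "real N + 1/2 \<in> c ` S"
    using mn by (rule_tac connectedD_interval[of "c ` S" "real m" "real n"]) auto
  then obtain s where s: "s \<in> S" "c s = real N + 1/2"
    by auto
  then obtain l where "1 \<le> l" "s \<in> earring_circle l"
    using assms(2) by (auto simp: hawaiian_earring_eq_tail earring_tail_def)
  then have "real l = real N + 1/2"
    using c[of s l] s assms(2) by force
  then have "2 * l = 2 * N + 1"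
    by linarith
  then show False
    by presburger
qed

section \<open>Loops, their classes, and the decomposition of loops\<close>

lemma he_loops_iff:
  "p \<in> he_loops \<longleftrightarrow> path p \<and> path_image p \<subseteq> hawaiian_earring \<and>
     pathstart p = (0, 0) \<and> pathfinish p = (0, 0)"
  by (simp add: he_loops_def)

lemma he_loops_join: "p \<in> he_loops \<Longrightarrow> q \<in> he_loops \<Longrightarrow> p +++ q \<in> he_loops"
  by (auto simp: he_loops_iff path_image_join)

lemma he_loops_const: "linepath (0, 0) (0, 0) \<in> he_loops"
  by (simp add: he_loops_iff zero_in_hawaiian_earring)

lemma he_class_eqI:
  assumes "homotopic_paths hawaiian_earring p q"
  shows "he_class p = he_class q"
  using assms unfolding he_class_def
  by (auto intro: homotopic_paths_trans homotopic_paths_sym)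

text \<open>Products and projections are defined through representatives picked by
  \<open>SOME\<close>; this allows computing with any given loop instead.\<close>

lemma homotopic_he_class_rep:
  assumes "p \<in> he_loops"
  shows "homotopic_paths hawaiian_earring p (SOME q. q \<in> he_class p)"
proof -
  have "p \<in> he_class p"
    using assms by (simp add: he_class_def he_loops_iff)
  then have "(SOME q. q \<in> he_class p) \<in> he_class p"
    by (rule someI[of "\<lambda>q. q \<in> he_class p"])
  then show ?thesis
    by (simp add: he_class_def)
qed

lemma he_class_in_carrier: "p \<in> he_loops \<Longrightarrow> he_class p \<in> carrier HE_group"
  by (simp add: HE_group_def)

lemma he_class_mult:
  assumes "p \<in> he_loops" "q \<in> he_loops"
  shows "he_class p \<otimes>\<^bsub>HE_group\<^esub> he_class q = he_class (p +++ q)"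
proof -
  have "homotopic_paths hawaiian_earring (p +++ q)
      ((SOME p'. p' \<in> he_class p) +++ (SOME q'. q' \<in> he_class q))"
    using assms by (intro homotopic_paths_join homotopic_he_class_rep) (auto simp: he_loops_iff)
  then show ?thesis
    by (simp add: HE_group_def he_class_eqI)
qed

lemma homotopic_he_retraction:
  assumes "homotopic_paths hawaiian_earring p q"
  shows "homotopic_paths hawaiian_earring (he_retraction N \<circ> p) (he_retraction N \<circ> q)"
  using assms
  by (rule homotopic_paths_continuous_image)
    (auto intro: continuous_on_he_retraction he_retraction_in)

lemma he_loops_retraction:
  assumes "p \<in> he_loops"
  shows "he_retraction N \<circ> p \<in> he_loops"
proof -
  have "homotopic_paths hawaiian_earring (he_retraction N \<circ> p) (he_retraction N \<circ> p)"
    using assms by (intro homotopic_he_retraction) (auto simp: he_loops_iff)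
  then show ?thesis
    using assms homotopic_paths_imp_path homotopic_paths_imp_subset
    by (simp add: he_loops_iff pathstart_compose pathfinish_compose he_retraction_zero)
qed

lemma he_proj_class:
  assumes "p \<in> he_loops"
  shows "he_proj N (he_class p) = he_class (he_retraction N \<circ> p)"
  unfolding he_proj_def
  by (rule he_class_eqI[symmetric] homotopic_he_retraction homotopic_he_class_rep assms)+

lemma he_loops_subpath:
  assumes "p \<in> he_loops" "s \<in> {0..1}" "t \<in> {0..1}" "p s = (0, 0)" "p t = (0, 0)"
  shows "subpath s t p \<in> he_loops"
  using assms path_image_subpath_subset[of s t p]
  by (auto simp: he_loops_iff)

text \<open>Between consecutive visits to the base point a loop stays in a single circle, and only
  finitely many of these excursions leave a given ball; so a loop is a finite concatenation of
  small loops and of loops in the first \<open>N\<close> circles.\<close>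
lemma he_loop_induct [consumes 3, case_names join homotopic head small]:
  assumes p: "p \<in> he_loops" and \<epsilon>: "\<epsilon> > 0" "2 / real (Suc N) < \<epsilon>"
    and join: "\<And>q r. q \<in> he_loops \<Longrightarrow> r \<in> he_loops \<Longrightarrow> P q \<Longrightarrow> P r \<Longrightarrow> P (q +++ r)"
    and homotopic: "\<And>q r. q \<in> he_loops \<Longrightarrow> homotopic_paths hawaiian_earring q r \<Longrightarrow> P q \<Longrightarrow> P r"
    and head: "\<And>q. q \<in> he_loops \<Longrightarrow> path_image q \<subseteq> earring_head N \<Longrightarrow> P q"
    and small: "\<And>q. q \<in> he_loops \<Longrightarrow> path_image q \<subseteq> ball 0 \<epsilon> \<Longrightarrow> P q"
  shows "P p"
proof -
  have path: "path p" "path_image p \<subseteq> hawaiian_earring" "p 0 = (0, 0)" "p 1 = (0, 0)"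
    using p by (auto simp: he_loops_iff pathstart_def pathfinish_def)
  then have cont: "continuous_on {0..1} p"
    by (simp add: path_def)
  then have "uniformly_continuous_on {0..1} p"
    by (rule compact_uniformly_continuous) simp
  then obtain \<delta> where \<delta>: "\<delta> > 0"
    and unif: "\<And>s t. s \<in> {0..1} \<Longrightarrow> t \<in> {0..1} \<Longrightarrow> dist t s < \<delta> \<Longrightarrow> dist (p t) (p s) < \<epsilon>"
    using \<epsilon>(1) unfolding uniformly_continuous_on_def by metis
  define Z where "Z = {t \<in> {0..1}. p t = (0, 0)}"
  have closed_Z: "closed Z"
    unfolding Z_def using continuous_closed_preimage_constant[OF cont] by simp
  have Z: "t \<in> {0..1}" "p t = (0, 0)" if "t \<in> Z" for t
    using that by (auto simp: Z_def)
  have loop: "subpath s t p \<in> he_loops" if "s \<in> Z" "t \<in> Z" for s t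
    using that p by (intro he_loops_subpath) (auto simp: Z_def)
  have chain: "P (subpath 0 t p)" if "P (subpath 0 s p)" "P (subpath s t p)" "s \<in> Z" "t \<in> Z" for s t
  proof (rule homotopic)
    have "0 \<in> Z"
      using path by (simp add: Z_def)
    then show "P (subpath 0 s p +++ subpath s t p)" "subpath 0 s p +++ subpath s t p \<in> he_loops"
      using that loop by (auto intro: join he_loops_join)
    show "homotopic_paths hawaiian_earring (subpath 0 s p +++ subpath s t p) (subpath 0 t p)"
      using that Z path by (intro homotopic_join_subpaths) auto
  qed
  \<comment> \<open>Here \<open>\<delta>\<close> comes from uniform continuity: between two visits
    closer than \<open>\<delta>\<close> the loop stays within \<open>\<epsilon>\<close> of the base
    point.\<close>
  have short: "P (subpath s t p)" if "s \<in> Z" "t \<in> Z" "s \<le> t" "t - s < \<delta>" for s t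
  proof (rule small)
    have "norm (p x) < \<epsilon>" if "x \<in> {s..t}" for x
      using unif[of s x] Z[OF \<open>s \<in> Z\<close>] Z[OF \<open>t \<in> Z\<close>] that \<open>t - s < \<delta>\<close>
      by (auto simp: dist_real_def simp flip: zero_prod_def)
    then show "path_image (subpath s t p) \<subseteq> ball 0 \<epsilon>"
      using that(3) by (auto simp: path_image_subpath)
  qed (use that loop in auto)
  \<comment> \<open>An excursion between consecutive visits is connected and avoids the origin, so
    it lies in the first \<open>N\<close> circles or in the later ones; the latter fit into the ball
    because \<open>2 / real (Suc N) < \<epsilon>\<close>.\<close>
  have gap: "P (subpath s t p)" if st: "s \<in> Z" "t \<in> Z" "s \<le> t" "{s<..<t} \<inter> Z = {}" for s t
  proof (cases "s = t")
    case False
    have sub: "{s<..<t} \<subseteq> {0..1}"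
      using Z(1)[OF st(1)] Z(1)[OF st(2)] by auto
    have "connected (p ` {s<..<t})"
      using continuous_on_subset[OF cont sub] by (rule connected_continuous_image) simp
    moreover have "p ` {s<..<t} \<subseteq> hawaiian_earring - {(0, 0)}"
    proof (intro image_subsetI DiffI)
      fix x assume x: "x \<in> {s<..<t}"
      then have "x \<in> {0..1}" "x \<notin> Z"
        using sub st(4) by blast+
      then show "p x \<in> hawaiian_earring" "p x \<notin> {(0, 0)}"
        using path(2) by (auto simp: Z_def path_image_def)
    qed
    ultimately have "p ` {s<..<t} \<subseteq> earring_head N \<or> p ` {s<..<t} \<subseteq> earring_tail (Suc N)"
      by (rule connected_hawaiian_earring_subset)
    moreover have image: "path_image (subpath s t p) = insert (0, 0) (p ` {s<..<t})"
    proof -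
      have "{s..t} = {s, t} \<union> {s<..<t}"
        using st(3) by auto
      then show ?thesis
        using Z st by (auto simp: path_image_subpath)
    qed
    moreover have "norm q < \<epsilon>" if q: "q \<in> earring_tail (Suc N)" for q
    proof -
      obtain n where n: "Suc N \<le> n" "q \<in> earring_circle n"
        using q by (auto simp: earring_tail_def)
      have "norm q \<le> 2 / real n"
        by (rule norm_le_earring_circle) fact
      also have "\<dots> \<le> 2 / real (Suc N)"
        using n(1) by (intro divide_left_mono) auto
      finally show ?thesis
        using \<epsilon>(2) by linarith
    qed
    ultimately consider "path_image (subpath s t p) \<subseteq> insert (0, 0) (earring_head N)"
      | "path_image (subpath s t p) \<subseteq> ball 0 \<epsilon>"
      using \<epsilon>(1) by (force simp flip: zero_prod_def)
    then show ?thesis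
    proof cases
      case 1
      show ?thesis
      \<comment> \<open>For \<open>N = 0\<close> the head is empty and does not contain the base
        point, so the constant loop counts as small.\<close>
      proof (cases "N = 0")
        case True
        then show ?thesis
          using 1 \<epsilon>(1) loop st
          by (intro small) (auto simp: earring_head_def simp flip: zero_prod_def)
      next
        case False
        then have "(0, 0) \<in> earring_head N"
          using zero_in_earring_circle[of 1] by (force simp: earring_head_def)
        then show ?thesis
          using 1 loop st by (intro head) auto
      qed
    qed (use loop st in \<open>auto intro: small\<close>)
  qed (use short[of s s] st \<delta> in auto)
  \<comment> \<open>Induction along a grid of mesh \<open>\<delta> / 2\<close>. If \<open>t\<close>
    lies beyond the grid point \<open>a\<close>, let \<open>s\<close> be the last visit up to
    \<open>a\<close> and \<open>u\<close> the first one from \<open>a\<close> on. The pieces are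
    \<open>[0, s]\<close> by induction, the gap \<open>[s, u]\<close>, and \<open>[u, t]\<close>,
    which is short.\<close>
  have initial: "P (subpath 0 t p)" if "t \<in> Z" "t \<le> real n * (\<delta> / 2)" for t n
    using that
  proof (induction n arbitrary: t)
    case 0
    then have "t = 0"
      using Z by force
    then show ?case
      using short[of 0 0] 0 \<delta> by simp
  next
    case (Suc n)
    define a where "a = real n * (\<delta> / 2)"
    show ?case
    proof (cases "t \<le> a")
      case True
      then show ?thesis
        using Suc by (simp add: a_def)
    next
      case False
      define s where "s = Sup (Z \<inter> {..a})"
      define u where "u = Inf (Z \<inter> {a..})"
      have "0 \<in> Z \<inter> {..a}" "bdd_above (Z \<inter> {..a})"
        using path \<delta> by (auto simp: Z_def a_def)
      then have s: "s \<in> Z \<inter> {..a}"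
        unfolding s_def using closed_Z by (intro closed_contains_Sup closed_Int) auto
      have "t \<in> Z \<inter> {a..}" and below: "bdd_below (Z \<inter> {a..})"
        using Suc.prems False by auto
      then have u: "u \<in> Z \<inter> {a..}"
        unfolding u_def using closed_Z by (intro closed_contains_Inf closed_Int) auto
      have "u \<le> t"
        unfolding u_def using \<open>t \<in> Z \<inter> {a..}\<close> below by (rule cInf_lower)
      have "{s<..<u} \<inter> Z = {}"
      proof (rule ccontr)
        assume "{s<..<u} \<inter> Z \<noteq> {}"
        then obtain x where x: "s < x" "x < u" "x \<in> Z"
          by auto
        show False
        proof (cases "x \<le> a")
          case True
          then have "x \<le> s"
            unfolding s_def using x \<open>bdd_above (Z \<inter> {..a})\<close> by (intro cSup_upper) auto
          then show False
            using x by simp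
        next
          case False
          then have "u \<le> x"
            unfolding u_def using x below by (intro cInf_lower) auto
          then show False
            using x by simp
        qed
      qed
      moreover have "P (subpath 0 s p)"
        using s by (intro Suc.IH) (auto simp: a_def)
      moreover have "t - u < \<delta>"
        using u Suc.prems \<delta> by (auto simp: a_def field_simps)
      ultimately show ?thesis
        using s u \<open>u \<le> t\<close> Suc.prems
        by (intro chain[of u t] chain[of s u] gap[of s u] short[of u t]) auto
    qed
  qed
  obtain n where "1 / (\<delta> / 2) < real n"
    using reals_Archimedean2 by blast
  then have "P (subpath 0 1 p)"
    using \<delta> path by (intro initial[of 1 n]) (auto simp: Z_def field_simps)
  then show "P p"
    by simp
qed

section \<open>Powers and infinite concatenations of loops\<close>

primrec path_power :: "(real \<Rightarrow> real \<times> real) \<Rightarrow> nat \<Rightarrow> real \<Rightarrow> real \<times> real" where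
  "path_power p 0 = linepath (0, 0) (0, 0)"
| "path_power p (Suc n) = path_power p n +++ p"

lemma he_loops_power: "p \<in> he_loops \<Longrightarrow> path_power p n \<in> he_loops"
  by (induction n) (auto intro: he_loops_join he_loops_const)

text \<open>A general relation \<open>R\<close> serves both distance bounds and norm bounds. Each
  point of a concatenation is a point of one of its two pieces at a parameter in the unit
  interval.\<close>

lemma joinpaths_cong_unit:
  assumes "\<And>t. t \<in> {0..1} \<Longrightarrow> R (p t) (p' t)" "\<And>t. t \<in> {0..1} \<Longrightarrow> R (q t) (q' t)" "t \<in> {0..1}"
  shows "R ((p +++ q) t) ((p' +++ q') t)"
  using assms by (auto simp: joinpaths_def)

lemma path_power_cong_unit:
  assumes "\<And>t. t \<in> {0..1} \<Longrightarrow> R (p t) (q t)" "R (0, 0) (0, 0)" "t \<in> {0..1}"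
  shows "R (path_power p n t) (path_power q n t)"
  using assms(3)
proof (induction n arbitrary: t)
  case (Suc n)
  then show ?case
    unfolding path_power.simps by (intro joinpaths_cong_unit[of R] assms(1)) auto
qed (use assms(2) in \<open>simp add: linepath_def flip: zero_prod_def\<close>)

lemma tendsto_joinpaths:
  assumes "\<And>t. t \<in> {0..1} \<Longrightarrow> ((\<lambda>d. p d t) \<longlongrightarrow> p' t) F"
    and "\<And>t. t \<in> {0..1} \<Longrightarrow> ((\<lambda>d. q d t) \<longlongrightarrow> q' t) F" and "t \<in> {0..1}"
  shows "((\<lambda>d. (p d +++ q d) t) \<longlongrightarrow> (p' +++ q') t) F"
  using assms by (auto simp: joinpaths_def)

lemma tendsto_path_power:
  assumes "\<And>t. t \<in> {0..1} \<Longrightarrow> ((\<lambda>d. p d t) \<longlongrightarrow> p' t) F" "t \<in> {0..1}"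
  shows "((\<lambda>d. path_power (p d) n t) \<longlongrightarrow> path_power p' n t) F"
  using assms(2)
proof (induction n arbitrary: t)
  case (Suc n)
  then show ?case
    unfolding path_power.simps by (intro tendsto_joinpaths assms(1)) auto
qed simp

text \<open>Concatenation only reparametrizes, so inserting a loop does not increase uniform
  distances. Hence the finite words converge uniformly as soon as the letters shrink, whatever the
  exponents are, and the limits stay in the earring because it is closed.\<close>

lemma infinite_nested_loops:
  fixes h :: "nat \<Rightarrow> real \<Rightarrow> real \<times> real" and k :: "nat \<Rightarrow> nat"
  assumes h: "\<And>n. h n \<in> he_loops" and small: "\<And>n. path_image (h n) \<subseteq> ball 0 (1 / real (Suc n))"
  obtains y where "\<And>n. y n \<in> he_loops"
    and "\<And>n. homotopic_paths hawaiian_earring (y n) (h n +++ path_power (y (Suc n)) (k n))"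
proof -
  define f where "f = (\<lambda>n p. h n +++ path_power p (k n))"
  define c where "c = linepath (0::real, 0::real) (0, 0)"
  have c: "c t = (0, 0)" for t
    by (simp add: c_def linepath_def flip: zero_prod_def)
  define \<sigma> where "\<sigma> = (\<lambda>n d. nested f n d c)"
  have \<sigma>_Suc: "\<sigma> n (Suc d) = h n +++ path_power (\<sigma> (Suc n) d) (k n)" for n d
    unfolding \<sigma>_def nested_Suc_left by (simp add: f_def)
  have loop: "\<sigma> n d \<in> he_loops" for n d
    unfolding \<sigma>_def
    by (rule nested_invariant[of _ _ "\<lambda>p. p \<in> he_loops"])
      (auto simp: f_def c_def intro: he_loops_const he_loops_join he_loops_power h)
  have close: "dist (nested f n d p t) (nested f n d q t) \<le> r"
    if "\<And>t. t \<in> {0..1} \<Longrightarrow> dist (p t) (q t) \<le> r" "t \<in> {0..1}" for n d p q r t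
    using that
  proof (induction d arbitrary: p q)
    case (Suc d)
    have "0 \<le> r"
      using Suc.prems by (meson order_trans zero_le_dist)
    have "dist (f (n + d) p t) (f (n + d) q t) \<le> r" if "t \<in> {0..1}" for t
      unfolding f_def using Suc.prems(1) \<open>0 \<le> r\<close> that
      by (intro joinpaths_cong_unit[of "\<lambda>x y. dist x y \<le> r"]
          path_power_cong_unit[of "\<lambda>x y. dist x y \<le> r"]) auto
    then show ?case
      using Suc by simp
  qed simp
  \<comment> \<open>The separate parameter \<open>m\<close> keeps the bound fixed while the
    induction passes from \<open>n\<close> to \<open>Suc n\<close>.\<close>
  have norm_le: "norm (\<sigma> n d t) \<le> 1 / real (Suc m)" if "m \<le> n" "t \<in> {0..1}" for m n d t
    using that
  proof (induction d arbitrary: n t)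
    case (Suc d)
    have "norm (h n t) \<le> 1 / real (Suc m)" if "t \<in> {0..1}" for t
    proof -
      have "norm (h n t) < 1 / real (Suc n)"
        using subsetD[OF small, of "h n t" n] that by (simp add: path_image_def)
      also have "\<dots> \<le> 1 / real (Suc m)"
        using Suc.prems by (intro divide_left_mono) auto
      finally show ?thesis by simp
    qed
    moreover have "norm (path_power (\<sigma> (Suc n) d) (k n) t) \<le> 1 / real (Suc m)" if "t \<in> {0..1}" for t
      using Suc that
      by (intro path_power_cong_unit[of "\<lambda>x y. norm x \<le> 1 / real (Suc m)"]) (auto simp flip: zero_prod_def)
    ultimately show ?case
      unfolding \<sigma>_Suc using Suc.prems
      by (intro joinpaths_cong_unit[of "\<lambda>x y. norm x \<le> 1 / real (Suc m)"]) auto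
  qed (simp add: \<sigma>_def c flip: zero_prod_def)
  \<comment> \<open>The two words differ only in the innermost loop,
    \<open>\<sigma> (n + d) d'\<close> against the constant loop, and the former has norm at most
    \<open>1 / real (Suc d)\<close>.\<close>
  have tail: "dist (\<sigma> n (d + d') t) (\<sigma> n d t) \<le> 1 / real (Suc d)" if "t \<in> {0..1}" for n d d' t
  proof -
    have "dist (nested f n d (\<sigma> (n + d) d') t) (nested f n d c t) \<le> 1 / real (Suc d)"
      using that norm_le[of d "n + d"] by (intro close) (auto simp: c simp flip: zero_prod_def)
    then show ?thesis
      by (simp add: \<sigma>_def nested_add)
  qed
  have "uniformly_Cauchy_on {0..1} (\<sigma> n)" for n
  proof (rule uniformly_Cauchy_onI')
    fix \<epsilon> :: real assume "\<epsilon> > 0"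
    then obtain M where M: "inverse (real (Suc M)) < \<epsilon>"
      using reals_Archimedean by blast
    have "dist (\<sigma> n m t) (\<sigma> n m' t) < \<epsilon>" if "t \<in> {0..1}" "M \<le> m" "m < m'" for t m m'
    proof -
      have "dist (\<sigma> n m t) (\<sigma> n m' t) \<le> 1 / real (Suc m)"
        using tail[OF that(1), of n m "m' - m"] that(3) by (simp add: dist_commute)
      also have "\<dots> \<le> 1 / real (Suc M)"
        using that(2) by (intro divide_left_mono) auto
      finally show ?thesis
        using M by (simp add: inverse_eq_divide)
    qed
    then show "\<exists>M. \<forall>t\<in>{0..1}. \<forall>m\<ge>M. \<forall>m'>m. dist (\<sigma> n m t) (\<sigma> n m' t) < \<epsilon>"
      by blast
  qed
  then have "\<exists>l. uniform_limit {0..1} (\<sigma> n) l sequentially" for n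
    using Cauchy_uniformly_convergent uniformly_convergent_on_def by blast
  then obtain y where y: "\<And>n. uniform_limit {0..1} (\<sigma> n) (y n) sequentially"
    by metis
  then have lim: "(\<lambda>d. \<sigma> n d t) \<longlonglongrightarrow> y n t" if "t \<in> {0..1}" for n t
    using that by (rule tendsto_uniform_limitI)
  have loop_y: "y n \<in> he_loops" for n
  proof -
    have "continuous_on {0..1} (y n)"
      by (rule uniform_limit_theorem[OF _ y])
        (use loop in \<open>auto simp: he_loops_iff path_def intro!: always_eventually\<close>)
    moreover have "y n t \<in> hawaiian_earring" if "t \<in> {0..1}" for t
      by (rule closed_sequentially[OF closed_hawaiian_earring _ lim[OF that]])
        (use loop that in \<open>fastforce simp: he_loops_iff path_image_def\<close>)
    moreover have "y n t = (0, 0)" if "t = 0 \<or> t = 1" for t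
    proof -
      have "(\<lambda>d. \<sigma> n d t) = (\<lambda>d. (0, 0))"
        using loop that by (auto simp: he_loops_iff pathstart_def pathfinish_def)
      then show ?thesis
        using lim[of t n] that by (auto simp: LIMSEQ_const_iff)
    qed
    ultimately show ?thesis
      by (auto simp: he_loops_iff path_def path_image_def pathstart_def pathfinish_def)
  qed
  have "y n t = (h n +++ path_power (y (Suc n)) (k n)) t" if "t \<in> {0..1}" for n t
  proof (rule LIMSEQ_unique)
    show "(\<lambda>d. \<sigma> n (Suc d) t) \<longlonglongrightarrow> y n t"
      using lim[OF that] by (rule LIMSEQ_Suc)
    show "(\<lambda>d. \<sigma> n (Suc d) t) \<longlonglongrightarrow> (h n +++ path_power (y (Suc n)) (k n)) t"
      unfolding \<sigma>_Suc using that by (intro tendsto_joinpaths tendsto_path_power tendsto_const lim)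
  qed
  then have "homotopic_paths hawaiian_earring (y n) (h n +++ path_power (y (Suc n)) (k n))" for n
    using loop_y[of n] by (intro homotopic_paths_eq) (auto simp: he_loops_iff)
  then show thesis
    using that loop_y by blast
qed

text \<open>Either all loops in some ball around the base point are killed, and decomposing loops
  gives the factorization through a projection, or there are arbitrarily small loops with nontrivial
  image. In the second case all letters can be fixed first and the exponents computed
  afterwards.\<close>

lemma n_slender_if_annihilating_exponents:
  assumes "group G" and e: "annihilating_exponents G e"
  shows "n_slender G"
  unfolding n_slender_def
proof
  interpret group G by fact
  fix \<phi> assume \<phi>: "\<phi> \<in> hom HE_group G"
  define \<Phi> where "\<Phi> = (\<lambda>p. \<phi> (he_class p))"
  have \<Phi>_closed: "\<Phi> p \<in> carrier G" if "p \<in> he_loops" for p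
    using \<phi> he_class_in_carrier[OF that] by (auto simp: \<Phi>_def hom_def)
  have \<Phi>_join: "\<Phi> (p +++ q) = \<Phi> p \<otimes>\<^bsub>G\<^esub> \<Phi> q" if "p \<in> he_loops" "q \<in> he_loops" for p q
    using \<phi> that by (simp add: \<Phi>_def hom_mult he_class_in_carrier flip: he_class_mult)
  have \<Phi>_eq: "\<Phi> p = \<Phi> q" if "homotopic_paths hawaiian_earring p q" for p q
    using he_class_eqI[OF that] by (simp add: \<Phi>_def)
  \<comment> \<open>The constant loop is equal to its own square, so its image is an idempotent of
    the group \<open>G\<close>.\<close>
  have \<Phi>_const: "\<Phi> (linepath (0, 0) (0, 0)) = \<one>\<^bsub>G\<^esub>"
  proof -
    let ?c = "linepath (0::real, 0::real) (0, 0)"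
    have "?c +++ ?c = ?c"
      by (auto simp: joinpaths_def linepath_def simp flip: zero_prod_def)
    then have "\<Phi> ?c \<otimes>\<^bsub>G\<^esub> \<Phi> ?c = \<Phi> ?c"
      using \<Phi>_join[OF he_loops_const he_loops_const] by simp
    then show ?thesis
      using \<Phi>_closed[OF he_loops_const] by simp
  qed
  have \<Phi>_power: "\<Phi> (path_power p n) = \<Phi> p [^]\<^bsub>G\<^esub> n" if "p \<in> he_loops" for p n
    using that by (induction n) (simp_all add: \<Phi>_const \<Phi>_join he_loops_power)
  show "\<exists>N\<ge>1. \<forall>x\<in>carrier HE_group. \<phi> x = \<phi> (he_proj N x)"
  proof (cases "\<exists>\<epsilon>>0. \<forall>p\<in>he_loops. path_image p \<subseteq> ball 0 \<epsilon> \<longrightarrow> \<Phi> p = \<one>\<^bsub>G\<^esub>")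
    case True
    then obtain \<epsilon> where \<epsilon>: "\<epsilon> > 0"
      and killed: "\<And>p. p \<in> he_loops \<Longrightarrow> path_image p \<subseteq> ball 0 \<epsilon> \<Longrightarrow> \<Phi> p = \<one>\<^bsub>G\<^esub>"
      by blast
    obtain N where N: "2 / \<epsilon> < real N"
      using reals_Archimedean2 by blast
    have "0 < 2 / \<epsilon>"
      using \<epsilon> by simp
    then have "N \<ge> 1"
      using N by (cases N) auto
    have "2 / real (Suc N) < \<epsilon>"
      using N \<epsilon> by (simp add: field_simps)
    \<comment> \<open>On the generating loops: one in the head is fixed by the retraction, and a
      small one stays small under it, so that both values are 1.\<close>
    have "\<Phi> p = \<Phi> (he_retraction N \<circ> p)" if "p \<in> he_loops" for p
      using that \<epsilon> \<open>2 / real (Suc N) < \<epsilon>\<close>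
    proof (induction rule: he_loop_induct)
      case (join q r)
      have "\<Phi> (he_retraction N \<circ> (q +++ r)) =
          \<Phi> (he_retraction N \<circ> q) \<otimes>\<^bsub>G\<^esub> \<Phi> (he_retraction N \<circ> r)"
        unfolding path_compose_join using join by (intro \<Phi>_join he_loops_retraction)
      then show ?case
        using join by (simp add: \<Phi>_join comp_def)
    next
      case (homotopic q r)
      then show ?case
        using \<Phi>_eq[OF homotopic(2)] \<Phi>_eq[OF homotopic_he_retraction[OF homotopic(2)]]
        by (simp add: comp_def)
    next
      case (head q)
      then have "homotopic_paths hawaiian_earring q (he_retraction N \<circ> q)"
        by (intro homotopic_paths_eq) (auto simp: he_loops_iff path_image_def image_subset_iff he_retraction_eq)
      then show ?case
        by (rule \<Phi>_eq)
    next
      case (small q)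
      then have "path_image (he_retraction N \<circ> q) \<subseteq> ball 0 \<epsilon>"
        by (auto simp: path_image_def image_subset_iff
            intro: le_less_trans[OF norm_he_retraction_le])
      then have "\<Phi> (he_retraction N \<circ> q) = \<one>\<^bsub>G\<^esub>"
        using small by (intro killed he_loops_retraction)
      then show ?case
        using small by (simp add: killed comp_def)
    qed
    then have "\<forall>x\<in>carrier HE_group. \<phi> x = \<phi> (he_proj N x)"
      by (auto simp: HE_group_def \<Phi>_def he_proj_class)
    then show ?thesis
      using \<open>N \<ge> 1\<close> by blast
  next
    case False
    then have "\<exists>h\<in>he_loops. path_image h \<subseteq> ball 0 (1 / real (Suc n)) \<and> \<Phi> h \<noteq> \<one>\<^bsub>G\<^esub>" for n
      by (metis zero_less_divide_1_iff of_nat_0_less_iff zero_less_Suc)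
    then obtain h where h: "\<And>n. h n \<in> he_loops"
      and small: "\<And>n. path_image (h n) \<subseteq> ball 0 (1 / real (Suc n))"
      and nontrivial: "\<And>n. \<Phi> (h n) \<noteq> \<one>\<^bsub>G\<^esub>"
      by metis
    define g where "g = (\<lambda>n. \<Phi> (h n))"
    obtain y where y: "\<And>n. y n \<in> he_loops"
      and y_Suc: "\<And>n. homotopic_paths hawaiian_earring (y n) (h n +++ path_power (y (Suc n)) (e g n))"
      using infinite_nested_loops[OF h small] by blast
    have "range g \<subseteq> carrier G" "\<Phi> (y 0) \<in> carrier G"
      using \<Phi>_closed h y by (auto simp: g_def)
    then obtain N where N: "\<And>z. z 0 = \<Phi> (y 0) \<and>
        (\<forall>i\<le>N. z (Suc i) \<in> carrier G \<and> z i = g i \<otimes>\<^bsub>G\<^esub> z (Suc i) [^]\<^bsub>G\<^esub> e g i) \<Longrightarrow> g N = \<one>\<^bsub>G\<^esub>"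
      using e unfolding annihilating_exponents_def by blast
    have "\<Phi> (y i) = g i \<otimes>\<^bsub>G\<^esub> \<Phi> (y (Suc i)) [^]\<^bsub>G\<^esub> e g i" for i
      using \<Phi>_eq[OF y_Suc[of i]] h y by (simp add: g_def \<Phi>_join \<Phi>_power he_loops_power)
    then have "g N = \<one>\<^bsub>G\<^esub>"
      using N[of "\<lambda>i. \<Phi> (y i)"] \<Phi>_closed y by blast
    then show ?thesis
      using nontrivial by (simp add: g_def)
  qed
qed

theorem theoremA:
  fixes G :: "('a, 'c) monoid_scheme"
  assumes "group G"
    and "\<exists>F k. limiting_sequence_pair G F k"
  shows "n_slender G \<and> cm_slender TYPE('b) G \<and> lcH_slender TYPE('d) G"
proof -
  obtain e where e: "annihilating_exponents G e"
    using assms annihilating_exponents_exist by blast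
  then show ?thesis
    unfolding cm_slender_def lcH_slender_def
    using assms(1) n_slender_if_annihilating_exponents completely_metrizable_open_kernel
      locally_compact_Hausdorff_open_kernel by blast
qed

end
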